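(* Let $s\ge 1$ and let $G$ be a metric star with center $c$ and $s$ spikes $cv_i$ of length one, for $i\in\{1,\dots,s\}$. Let $G_w$ be any graph obtained by adding $s-1$ wormholes to $G$. Then for some $i$ we have $d_{G_w}(c,v_i)=1$, and consequently $\mathrm{diam}(G_w)\ge 1$. This bound is tight: for every $s$ there is a choice of $s-1$ wormholes for which $\mathrm{diam}(G_w)=1$.
   Context: A metric graph is a finite edge-weighted graph regarded as a metric space in which all points in the interior of each edge are included and each edge is locally isometric to an interval whose length is the edge weight; $d_G(x,y)$ is the minimum length of a path from $x$ to $y$, and $\mathrm{diam}(G)=\max_{x,y\in G} d_G(x,y)$ over all points of $G$ (not only vertices). The metric star with $s$ spikes of length one consists of $s$ intervals $cv_i$ of length $1$ glued at the common endpoint $c$. A wormhole is a pair of points of $G$ (arbitrary points, not necessarily vertices); adding a wormhole means identifying its two points, equivalently adding an edge of length zero between them. $G_w$ is the metric graph obtained after all the identifications; points of $G$ are regarded as points of $G_w$ via the projection. Different wormholes may share points. *)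

theory Defs
  imports Complex_Main
begin

text \<open>
  A metric graph is given by finitely many closed intervals \<open>{0..weight e}\<close>, one for each edge, and
  a map \<open>point\<close> onto its points that glues the intervals together: \<open>point e t\<close> is the point at
  distance \<open>t\<close> from the first end of the edge \<open>e\<close>. Only finitely many positions may be
  glued to other positions. They need not be ends of the intervals: an interval glued in its
  interior is subdivided there into several edges of the graph in the combinatorial sense.
\<close>

record ('e, 'p) mgraph =
  edges :: "'e set"
  weight :: "'e \<Rightarrow> real"
  point :: "'e \<Rightarrow> real \<Rightarrow> 'p"

definition positions :: "('e, 'p) mgraph \<Rightarrow> ('e \<times> real) set" where
  "positions G = (SIGMA e:edges G. {0..weight G e})"

definition points :: "('e, 'p) mgraph \<Rightarrow> 'p set" where
  "points G = (\<lambda>(e, t). point G e t) ` positions G"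

definition metric_graph :: "('e, 'p) mgraph \<Rightarrow> bool" where
  "metric_graph G \<longleftrightarrow> finite (edges G) \<and> (\<forall>e\<in>edges G. 0 < weight G e) \<and>
     finite {(e, t) \<in> positions G.
       \<exists>(e', t') \<in> positions G. (e', t') \<noteq> (e, t) \<and> point G e' t' = point G e t}"

text \<open>
  \<open>graph_path G x l y\<close>: there is a path of length \<open>l\<close> from \<open>x\<close> to \<open>y\<close>, that is, a finite
  concatenation of segments, each traversed inside one edge.
\<close>

inductive graph_path :: "('e, 'p) mgraph \<Rightarrow> 'p \<Rightarrow> real \<Rightarrow> 'p \<Rightarrow> bool" for G where
  trivial: "x \<in> points G \<Longrightarrow> graph_path G x 0 x"
| segment: "\<lbrakk>(e, t) \<in> positions G; (e, u) \<in> positions G; graph_path G (point G e u) l y\<rbrakk>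
     \<Longrightarrow> graph_path G (point G e t) (\<bar>t - u\<bar> + l) y"

text \<open>In the connected metric graphs considered below, the infimum and the supremum are attained.\<close>

definition graph_dist :: "('e, 'p) mgraph \<Rightarrow> 'p \<Rightarrow> 'p \<Rightarrow> real" where
  "graph_dist G x y = Inf {l. graph_path G x l y}"

definition graph_diam :: "('e, 'p) mgraph \<Rightarrow> real" where
  "graph_diam G = (SUP (x, y) \<in> points G \<times> points G. graph_dist G x y)"

text \<open>
  Adding the wormholes \<open>W\<close> replaces points by their classes under the equivalence relation
  generated by \<open>W\<close>, where \<open>project W\<close> is the projection from \<open>G\<close> to the resulting graph.
\<close>

definition project :: "('p \<times> 'p) set \<Rightarrow> 'p \<Rightarrow> 'p set" where
  "project W p = (W \<union> W\<inverse>)\<^sup>* `` {p}"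

definition add_wormholes :: "('p \<times> 'p) set \<Rightarrow> ('e, 'p) mgraph \<Rightarrow> ('e, 'p set) mgraph" where
  "add_wormholes W G =
     \<lparr>edges = edges G, weight = weight G, point = (\<lambda>e t. project W (point G e t))\<rparr>"

text \<open>\<open>Spike i t\<close> with \<open>0 < t \<le> 1\<close> is the point of the \<open>i\<close>-th spike at distance \<open>t\<close> from the center.\<close>

datatype star_point = Center | Spike nat real

definition star :: "nat \<Rightarrow> (nat, star_point) mgraph" where
  "star s = \<lparr>edges = {1..s}, weight = (\<lambda>_. 1),
     point = (\<lambda>i t. if t = 0 then Center else Spike i t)\<rparr>"

abbreviation tip :: "nat \<Rightarrow> star_point" where
  "tip i \<equiv> Spike i 1"

lemma metric_graph_star: "metric_graph (star s)"
proof -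
  have "{(e, t) \<in> positions (star s). \<exists>(e', t') \<in> positions (star s).
      (e', t') \<noteq> (e, t) \<and> point (star s) e' t' = point (star s) e t} \<subseteq> {1..s} \<times> {0}"
    by (auto simp: positions_def star_def split: if_splits)
  then have "finite {(e, t) \<in> positions (star s). \<exists>(e', t') \<in> positions (star s).
      (e', t') \<noteq> (e, t) \<and> point (star s) e' t' = point (star s) e t}"
    by (rule finite_subset) simp
  then show ?thesis by (simp add: metric_graph_def star_def)
qed

lemma points_star:
  assumes "s \<ge> 1"
  shows "points (star s) = insert Center {Spike i t | i t. i \<in> {1..s} \<and> 0 < t \<and> t \<le> 1}"
proof -
  have "point (star s) 1 0 = Center" "(1, 0) \<in> positions (star s)"
    using assms by (auto simp: star_def positions_def)
  then have "Center \<in> points (star s)" unfolding points_def by force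
  moreover have "Spike i t \<in> points (star s)" if "i \<in> {1..s}" "0 < t" "t \<le> 1" for i t
  proof -
    have "point (star s) i t = Spike i t" "(i, t) \<in> positions (star s)"
      using that by (auto simp: star_def positions_def)
    then show ?thesis unfolding points_def by force
  qed
  moreover have "points (star s) \<subseteq> insert Center {Spike i t | i t. i \<in> {1..s} \<and> 0 < t \<and> t \<le> 1}"
    by (auto simp: star_def positions_def points_def)
  ultimately show ?thesis by auto
qed

lemma points_add_wormholes: "points (add_wormholes W G) = project W ` points G"
  by (auto simp: points_def positions_def add_wormholes_def image_iff)

lemma project_eq_iff: "project W p = project W q \<longleftrightarrow> (p, q) \<in> (W \<union> W\<inverse>)\<^sup>*"
proof -
  have s: "sym ((W \<union> W\<inverse>)\<^sup>*)" by (simp add: sym_Un_converse sym_rtrancl)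
  show ?thesis unfolding project_def
    by (auto dest: symD[OF s] intro: rtrancl_trans)
qed

lemma metric_graph_add_wormholes:
  assumes "metric_graph G" "finite W"
  shows "metric_graph (add_wormholes W G)"
proof -
  let ?f = "\<lambda>(e, t). point G e t"
  let ?P = "positions G"
  define B where "B = {(e, t) \<in> ?P. \<exists>(e', t') \<in> ?P. (e', t') \<noteq> (e, t) \<and> point G e' t' = point G e t}"
  define F where "F = fst ` W \<union> snd ` W"
  have fB: "finite B" and fF: "finite F"
    using assms by (auto simp: metric_graph_def B_def F_def)
  have "finite {x \<in> ?P. ?f x = p}" for p
  proof (cases "\<exists>x \<in> ?P. ?f x = p")
    case True
    then obtain e0 t0 where "(e0, t0) \<in> ?P" "point G e0 t0 = p" by auto
    then have "{x \<in> ?P. ?f x = p} \<subseteq> insert (e0, t0) B" by (force simp: B_def)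
    then show ?thesis using fB by (meson finite_insert finite_subset)
  next
    case False
    then have "{x \<in> ?P. ?f x = p} = {}" by blast
    then show ?thesis by (simp only: finite.emptyI)
  qed
  then have fin: "finite (B \<union> (\<Union>p\<in>F. {x \<in> ?P. ?f x = p}))" using fB fF by blast
  have mem: "p \<in> F" if "(q, p) \<in> (W \<union> W\<inverse>)\<^sup>*" "p \<noteq> q" for p q
    using that by (cases rule: rtrancl.cases) (force simp: F_def)+
  let ?G = "add_wormholes W G"
  have P: "positions ?G = ?P" by (simp add: positions_def add_wormholes_def)
  have "{(e, t) \<in> positions ?G. \<exists>(e', t') \<in> positions ?G. (e', t') \<noteq> (e, t) \<and> point ?G e' t' = point ?G e t}
      \<subseteq> B \<union> (\<Union>p\<in>F. {x \<in> ?P. ?f x = p})"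
  proof
    fix x
    assume "x \<in> {(e, t) \<in> positions ?G. \<exists>(e', t') \<in> positions ?G.
      (e', t') \<noteq> (e, t) \<and> point ?G e' t' = point ?G e t}"
    then obtain e t e' t' where x: "x = (e, t)" and a: "(e, t) \<in> ?P" "(e', t') \<in> ?P"
      "(e', t') \<noteq> (e, t)" "point ?G e' t' = point ?G e t"
      unfolding P by auto
    have "(point G e' t', point G e t) \<in> (W \<union> W\<inverse>)\<^sup>*"
      using a(4) by (simp add: add_wormholes_def project_eq_iff)
    then have "point G e t \<in> F \<or> point G e t = point G e' t'" using mem by blast
    then show "x \<in> B \<union> (\<Union>p\<in>F. {x \<in> ?P. ?f x = p})"
    proof
      assume "point G e t = point G e' t'"
      then show ?thesis using a(1-3) by (force simp: B_def x)
    qed (use a(1) x in auto)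
  qed
  from finite_subset[OF this fin] assms(1) show ?thesis
    by (auto simp: metric_graph_def add_wormholes_def)
qed

end

theory Submission
  imports Defs
begin

text \<open>
  Let \<open>d\<close> be the distance from the center in \<open>G\<^sub>w\<close> and suppose that all tips have
  \<open>d < 1\<close>. In each spike choose, among the tip and the ends of wormholes, a point \<open>p\<^sub>i\<close> of
  least \<open>d\<close> among those that are closer to the center than before (\<open>d\<close> smaller than the
  height). With fewer than \<open>s\<close> wormholes, some class of identified points consists of
  chosen points only. Then \<open>d\<close> can be raised slightly around this class so that it remains
  \<open>1\<close>-Lipschitz on every spike, invariant under \<open>W\<close> and zero at the center. Such a
  function is a lower bound for \<open>d\<close>, which is a contradiction. For the tightness, identify all tips.
\<close>

section \<open>Paths and distances in metric graphs\<close>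

lemma graph_path_nonneg: "graph_path G x l y \<Longrightarrow> 0 \<le> l"
  by (induction rule: graph_path.induct) auto

lemma graph_path_append:
  "graph_path G x l y \<Longrightarrow> graph_path G y m z \<Longrightarrow> graph_path G x (l + m) z"
proof (induction rule: graph_path.induct)
  case (segment e t u l y)
  then show ?case
    using graph_path.segment[of e t G u "l + m" z] by (simp add: add.assoc)
qed simp

lemma graph_path_segment:
  assumes "(e, t) \<in> positions G" "(e, u) \<in> positions G"
  shows "graph_path G (point G e t) \<bar>t - u\<bar> (point G e u)"
proof -
  have "point G e u \<in> points G"
    using assms(2) by (force simp: points_def)
  from graph_path.segment[OF assms graph_path.trivial[OF this]] show ?thesis by simp
qed

lemma graph_dist_le: "graph_path G x l y \<Longrightarrow> graph_dist G x y \<le> l"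
  unfolding graph_dist_def
  by (rule cInf_lower) (auto intro: bdd_belowI graph_path_nonneg)

lemma graph_dist_greatest:
  assumes "graph_path G x k y" "\<And>l. graph_path G x l y \<Longrightarrow> m \<le> l"
  shows "m \<le> graph_dist G x y"
  unfolding graph_dist_def by (rule cInf_greatest) (use assms in auto)

text \<open>Every path to \<open>y\<close> extends by the given one. The path of length
  \<open>k\<close> makes the set of lengths nonempty, since \<open>Inf\<close> of the empty set is
  unspecified.\<close>

lemma graph_dist_add_path:
  assumes "graph_path G x k y" "graph_path G y m z"
  shows "graph_dist G x z \<le> graph_dist G x y + m"
proof -
  have "graph_dist G x z - m \<le> graph_dist G x y"
    using assms(1)
  proof (rule graph_dist_greatest)
    fix l assume "graph_path G x l y"
    from graph_dist_le[OF graph_path_append[OF this assms(2)]]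
    show "graph_dist G x z - m \<le> l" by simp
  qed
  then show ?thesis by simp
qed

section \<open>Wormholes\<close>

lemma positions_add_wormholes [simp]: "positions (add_wormholes W G) = positions G"
  by (simp add: positions_def add_wormholes_def)

lemma point_add_wormholes [simp]: "point (add_wormholes W G) e t = project W (point G e t)"
  by (simp add: add_wormholes_def)

lemma self_in_project [simp]: "x \<in> project W x"
  by (simp add: project_def)

lemma project_eq_of_mem: "y \<in> project W x \<Longrightarrow> project W x = project W y"
  by (simp add: project_eq_iff) (simp add: project_def)

lemma project_const:
  assumes "\<And>x y. (x, y) \<in> W \<Longrightarrow> f x = f y" "y \<in> project W x"
  shows "f y = f x"
proof -
  have "(x, y) \<in> (W \<union> W\<inverse>)\<^sup>*" using assms(2) by (simp add: project_def)
  then show ?thesis by (induction rule: rtrancl_induct) (auto dest: assms(1))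
qed

text \<open>\<open>f\<close> serves as a potential: a segment changes it by at most its length, and
  a jump through wormholes leaves it unchanged. So any such \<open>f\<close> bounds distances from
  below, whichever representatives of the end classes are taken.\<close>

lemma lipschitz_le_path_length:
  fixes f :: "'p \<Rightarrow> real"
  assumes lip: "\<And>e t u. (e, t) \<in> positions G \<Longrightarrow> (e, u) \<in> positions G \<Longrightarrow>
      \<bar>f (point G e t) - f (point G e u)\<bar> \<le> \<bar>t - u\<bar>"
    and inv: "\<And>x y. (x, y) \<in> W \<Longrightarrow> f x = f y"
    and "graph_path (add_wormholes W G) X l Y" "x \<in> X" "y \<in> Y"
  shows "\<bar>f x - f y\<bar> \<le> l"
  using assms(3-5)
proof (induction arbitrary: x rule: graph_path.induct)
  case (trivial X)
  then obtain p where "X = project W p" by (auto simp: points_add_wormholes)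
  with trivial have "f x = f p" "f y = f p"
    using project_const[of W f, OF inv] by auto
  then show ?case by simp
next
  case (segment e t u l Y)
  have "\<bar>f (point G e u) - f y\<bar> \<le> l"
    by (rule segment.IH) (use segment.prems in auto)
  moreover have "f x = f (point G e t)"
    using project_const[of W f, OF inv] segment.prems by auto
  moreover have "\<bar>f (point G e t) - f (point G e u)\<bar> \<le> \<bar>t - u\<bar>"
    using lip segment.hyps by auto
  ultimately show ?case by linarith
qed

text \<open>
  Each point of \<open>A\<close> is charged to the first wormhole on a shortest chain that leads out of \<open>A\<close>.
\<close>

lemma card_le_card_of_escape:
  assumes "finite W" "\<And>a. a \<in> A \<Longrightarrow> \<not> project W a \<subseteq> A"
  shows "card A \<le> card W"
proof -
  define R where "R = W \<union> W\<inverse>"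
  define n where "n a = (LEAST k. \<exists>q. q \<notin> A \<and> (a, q) \<in> R ^^ k)" for a
  have "\<exists>e. e \<in> W \<and> (\<exists>b. (e = (a, b) \<or> e = (b, a)) \<and> n b < n a)" if a: "a \<in> A" for a
  proof -
    obtain q where "q \<notin> A" "(a, q) \<in> R\<^sup>*"
      using assms(2)[OF a] by (auto simp: project_def R_def)
    then have "\<exists>k q. q \<notin> A \<and> (a, q) \<in> R ^^ k"
      by (auto simp: rtrancl_is_UN_relpow)
    then have "\<exists>q. q \<notin> A \<and> (a, q) \<in> R ^^ n a"
      unfolding n_def by (rule LeastI_ex)
    then obtain q where q: "q \<notin> A" "(a, q) \<in> R ^^ n a" by blast
    with a obtain k where k: "n a = Suc k" by (cases "n a") auto
    with q obtain b where b: "(a, b) \<in> R" "(b, q) \<in> R ^^ k"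
      using relpow_Suc_D2 by metis
    have "n b \<le> k"
      unfolding n_def[of b] by (rule Least_le) (use q b in blast)
    with k have "n b < n a" by simp
    with b(1) show ?thesis unfolding R_def by blast
  qed
  then obtain g where g: "\<And>a. a \<in> A \<Longrightarrow> g a \<in> W \<and> (\<exists>b. (g a = (a, b) \<or> g a = (b, a)) \<and> n b < n a)"
    by metis
  have "inj_on g A"
  proof (rule inj_onI)
    fix a a' assume "a \<in> A" "a' \<in> A" "g a = g a'"
    \<comment> \<open>If distinct \<open>a\<close> and \<open>a'\<close> were charged to the same
      wormhole, each would be the successor of the other, giving both \<open>n a' < n a\<close> and
      \<open>n a < n a'\<close>.\<close>
    then show "a = a'" using g[of a] g[of a'] by auto
  qed
  then show ?thesis by (rule card_inj_on_le) (use g assms(1) in auto)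
qed

section \<open>Stars with wormholes\<close>

definition spike_point :: "nat \<Rightarrow> real \<Rightarrow> star_point" where
  "spike_point i t = (if t = 0 then Center else Spike i t)"

lemma spike_point_simps [simp]: "spike_point i 0 = Center" "spike_point i 1 = tip i"
  by (auto simp: spike_point_def)

lemma point_star [simp]: "point (star s) = spike_point"
  by (simp add: star_def spike_point_def fun_eq_iff)

lemma positions_star [simp]: "(i, t) \<in> positions (star s) \<longleftrightarrow> i \<in> {1..s} \<and> 0 \<le> t \<and> t \<le> 1"
  by (auto simp: star_def positions_def)

lemma points_starE:
  assumes "x \<in> points (star s)"
  obtains i t where "x = spike_point i t" "i \<in> {1..s}" "0 \<le> t" "t \<le> 1"
  using assms by (auto simp: points_def)

lemma star_wormholes_segment:
  assumes "i \<in> {1..s}" "0 \<le> t" "t \<le> 1" "0 \<le> u" "u \<le> 1"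
  shows "graph_path (add_wormholes W (star s))
    (project W (spike_point i t)) \<bar>t - u\<bar> (project W (spike_point i u))"
  using graph_path_segment[of i t "add_wormholes W (star s)" u] assms by simp

lemma star_wormholes_path_via_center:
  assumes "i \<in> {1..s}" "0 \<le> t" "t \<le> 1" "j \<in> {1..s}" "0 \<le> u" "u \<le> 1"
  shows "graph_path (add_wormholes W (star s))
    (project W (spike_point i t)) (t + u) (project W (spike_point j u))"
  using star_wormholes_segment[of i s t 0 W] star_wormholes_segment[of j s 0 u W] assms
  by (auto intro: graph_path_append)

section \<open>A tip that stays at distance one from the center\<close>

lemma exists_tip_dist_one:
  assumes "finite W" "W \<subseteq> points (star s) \<times> points (star s)" "card W < s"
  shows "\<exists>i\<in>{1..s}. graph_dist (add_wormholes W (star s)) (project W Center) (project W (tip i)) = 1"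
proof (rule ccontr)
  define d where "d x = graph_dist (add_wormholes W (star s)) (project W Center) (project W x)" for x
  assume "\<not> ?thesis"
  then have ne: "d (tip i) \<noteq> 1" if "i \<in> {1..s}" for i using that by (auto simp: d_def)
  have path: "graph_path (add_wormholes W (star s)) (project W Center) t (project W (spike_point i t))"
    if "i \<in> {1..s}" "0 \<le> t" "t \<le> 1" for i t
    using star_wormholes_segment[of i s 0 t W] that by simp
  have d_le: "d (spike_point i t) \<le> t" if "i \<in> {1..s}" "0 \<le> t" "t \<le> 1" for i t
    unfolding d_def by (rule graph_dist_le[OF path[OF that]])
  have d_lip1: "d (spike_point i t) \<le> d (spike_point i u) + \<bar>u - t\<bar>"
    if "i \<in> {1..s}" "0 \<le> t" "t \<le> 1" "0 \<le> u" "u \<le> 1" for i t u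
    unfolding d_def by (rule graph_dist_add_path[OF path star_wormholes_segment]) (use that in auto)
  have d_lip: "\<bar>d (spike_point i t) - d (spike_point i u)\<bar> \<le> \<bar>t - u\<bar>"
    if "i \<in> {1..s}" "0 \<le> t" "t \<le> 1" "0 \<le> u" "u \<le> 1" for i t u
    using d_lip1[of i t u] d_lip1[of i u t] that by linarith
  have d_inv: "d x = d y" if "y \<in> project W x" for x y
    using project_eq_of_mem[OF that] by (simp add: d_def)
  have s: "1 \<in> {1..s}" using assms(3) by simp
  have d_nonneg: "0 \<le> d (spike_point i t)" if "i \<in> {1..s}" "0 \<le> t" "t \<le> 1" for i t
    unfolding d_def by (rule graph_dist_greatest[OF path[OF that]]) (rule graph_path_nonneg)
  have d_center: "d Center = 0"
    using d_le[OF s, of 0] d_nonneg[OF s, of 0] by simp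
  have tip_less: "d (tip i) < 1" if "i \<in> {1..s}" for i
    using d_le[OF that, of 1] ne[OF that] by simp

  \<comment> \<open>Candidate heights on a spike: the wormhole ends, where invariance has to be
    checked, and the tip, which is closer than before by assumption and so makes the choice of
    \<open>h\<close> possible.\<close>
  define H where "H i = {t. 0 < t \<and> t \<le> 1 \<and> (t = 1 \<or> Spike i t \<in> Domain W \<union> Range W)}" for i
  have fin_H: "finite (H i)" for i
  proof (rule finite_subset)
    \<comment> \<open>The value \<open>0\<close> for the center is a dummy; only finiteness of this
      superset matters.\<close>
    show "H i \<subseteq> insert 1 ((\<lambda>x. case x of Center \<Rightarrow> 0 | Spike _ t \<Rightarrow> t) ` (Domain W \<union> Range W))"
      by (force simp: H_def)
    show "finite (insert 1 ((\<lambda>x. case x of Center \<Rightarrow> 0 | Spike _ t \<Rightarrow> t) ` (Domain W \<union> Range W)) :: real set)"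
      using assms(1) by (simp add: finite_Domain finite_Range)
  qed
  have "\<exists>t \<in> H i. d (Spike i t) < t \<and> (\<forall>u \<in> H i. d (Spike i u) < u \<longrightarrow> d (Spike i t) \<le> d (Spike i u))"
    if i: "i \<in> {1..s}" for i
  proof -
    let ?S = "{t \<in> H i. d (Spike i t) < t}"
    have "1 \<in> ?S" using tip_less[OF i] by (simp add: H_def)
    then have ne: "?S \<noteq> {}" by blast
    have fin: "finite ?S" using fin_H by simp
    obtain t where "is_arg_min (\<lambda>t. d (Spike i t)) (\<lambda>t. t \<in> ?S) t"
      using ex_is_arg_min_if_finite[OF fin ne] by blast
    then show ?thesis by (auto simp: is_arg_min_linorder)
  qed
  then obtain h where h: "\<And>i. i \<in> {1..s} \<Longrightarrow> h i \<in> H i" "\<And>i. i \<in> {1..s} \<Longrightarrow> d (Spike i (h i)) < h i"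
    and h_min: "\<And>i u. i \<in> {1..s} \<Longrightarrow> u \<in> H i \<Longrightarrow> d (Spike i u) < u \<Longrightarrow> d (Spike i (h i)) \<le> d (Spike i u)"
    by metis
  have h01: "0 < h i" "h i \<le> 1" if "i \<in> {1..s}" for i
    using h(1)[OF that] by (auto simp: H_def)

  define A where "A = (\<lambda>i. Spike i (h i)) ` {1..s}"
  have "card A = s" unfolding A_def by (subst card_image) (auto intro: inj_onI)
  \<comment> \<open>There is one chosen point per spike, hence more of them than wormholes, so they
    cannot all have a chain leading out of \<open>A\<close>.\<close>
  then have "\<exists>a\<in>A. project W a \<subseteq> A"
    using card_le_card_of_escape[OF assms(1), of A] assms(3) by force
  then obtain a where a: "a \<in> A" "project W a \<subseteq> A" by blast
  define K where "K = project W a"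
  define I where "I = {i \<in> {1..s}. Spike i (h i) \<in> K}"
  have dK: "d x = d a" if "x \<in> K" for x
    using d_inv[of x a] that by (simp add: K_def)
  have K_A: "\<exists>i \<in> I. x = Spike i (h i)" if "x \<in> K" for x
    using a(2) that by (auto simp: K_def A_def I_def)
  have aK: "a \<in> K" by (simp add: K_def)

  \<comment> \<open>Upper bounds for the raise \<open>\<epsilon>\<close>. The bounds
    \<open>h i - d a\<close> keep the tent of height \<open>d a + \<epsilon>\<close> around
    \<open>h i\<close> nonpositive at the center; the bounds \<open>\<bar>u - h i\<bar>\<close> keep
    it at most \<open>d a\<close> at the other candidate heights. The \<open>1\<close> makes
    \<open>E\<close> visibly nonempty.\<close>
  define E where "E = insert 1 ((\<lambda>i. h i - d a) ` I \<union> (\<Union>i\<in>I. (\<lambda>u. \<bar>u - h i\<bar>) ` (H i - {h i})))"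
  have "finite I" by (simp add: I_def)
  then have fin_E: "finite E" using fin_H by (simp add: E_def)
  have E_pos: "0 < x" if "x \<in> E" for x
  proof -
    have "d a < h i" if "i \<in> I" for i
      using h(2)[of i] dK[of "Spike i (h i)"] that by (simp add: I_def)
    then show ?thesis using that by (auto simp: E_def)
  qed
  define \<epsilon> where "\<epsilon> = Min E"
  have \<epsilon>_pos: "0 < \<epsilon>" using E_pos Min_in[OF fin_E] by (auto simp: \<epsilon>_def E_def)
  have \<epsilon>_le: "\<epsilon> \<le> x" if "x \<in> E" for x using fin_E that by (simp add: \<epsilon>_def)
  have \<epsilon>_le1: "\<epsilon> \<le> h i - d a" if "i \<in> I" for i
    by (rule \<epsilon>_le) (use that in \<open>auto simp: E_def\<close>)
  have \<epsilon>_le2: "\<epsilon> \<le> \<bar>u - h i\<bar>" if "i \<in> I" "u \<in> H i" "u \<noteq> h i" for i u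
    by (rule \<epsilon>_le) (use that in \<open>auto simp: E_def\<close>)

  \<comment> \<open>On each spike meeting \<open>K\<close>, take the maximum of \<open>d\<close> and
    a tent of slope one with its peak at \<open>h i\<close>. A maximum of two 1-Lipschitz functions
    is again 1-Lipschitz.\<close>
  define f where "f x = (case x of Center \<Rightarrow> 0 | Spike i t \<Rightarrow>
    if i \<in> I then max (d x) (d a + \<epsilon> - \<bar>t - h i\<bar>) else d x)" for x
  have f_spike: "f (spike_point i t) = (if i \<in> I
      then max (d (spike_point i t)) (d a + \<epsilon> - \<bar>t - h i\<bar>) else d (spike_point i t))"
    if "0 \<le> t" for i t
  proof (cases "t = 0")
    case True
    then show ?thesis
      using \<epsilon>_le1[of i] h01[of i] by (auto simp: f_def d_center I_def)
  qed (simp add: f_def spike_point_def)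
  have f_lip: "\<bar>f (spike_point i t) - f (spike_point i u)\<bar> \<le> \<bar>t - u\<bar>"
    if "i \<in> {1..s}" "0 \<le> t" "t \<le> 1" "0 \<le> u" "u \<le> 1" for i t u
    using d_lip[OF that] that by (auto simp: f_spike max_def abs_if split: if_splits)
  have f_K: "f x = d a + \<epsilon>" if "x \<in> K" for x
    using K_A[OF that] dK[OF that] \<epsilon>_pos by (auto simp: f_def)
  have f_else: "f x = d x" if "x \<in> Domain W \<union> Range W" "x \<notin> K" for x
  proof (cases x)
    case Center
    then show ?thesis by (simp add: f_def d_center)
  next
    case (Spike i t)
    \<comment> \<open>If \<open>d x < t\<close>, then \<open>x\<close> competed in the choice of
      \<open>h i\<close>, so \<open>d a \<le> d x\<close>, and the tent is at most
      \<open>d a\<close> at \<open>t\<close>. Otherwise \<open>d a + \<epsilon> \<le> h i\<close>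
      bounds the tent by \<open>h i - \<bar>t - h i\<bar> \<le> t \<le> d x\<close>.\<close>
    have "d a + \<epsilon> - \<bar>t - h i\<bar> \<le> d x" if i: "i \<in> I"
    proof -
      have "x \<in> points (star s)" using \<open>x \<in> Domain W \<union> Range W\<close> assms(2) by auto
      then have "t \<in> H i" "i \<in> {1..s}"
        using Spike \<open>x \<in> Domain W \<union> Range W\<close> s by (auto simp: points_star H_def)
      moreover have "t \<noteq> h i" using i Spike \<open>x \<notin> K\<close> by (auto simp: I_def)
      moreover have "d (Spike i (h i)) = d a" using i by (auto simp: I_def dK)
      ultimately show ?thesis
        using h_min[of i t] \<epsilon>_le1[OF i] \<epsilon>_le2[OF i, of t] Spike
        by (cases "d x < t") (auto simp: abs_if split: if_splits)
    qed
    with Spike show ?thesis by (simp add: f_def)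
  qed
  have f_inv: "f x = f y" if "(x, y) \<in> W" for x y
  proof -
    have y: "y \<in> project W x" using that by (auto simp: project_def)
    have "x \<in> K \<longleftrightarrow> y \<in> K"
      using project_eq_of_mem[OF y] unfolding K_def by (metis project_eq_of_mem self_in_project)
    moreover have "x \<in> Domain W \<union> Range W" "y \<in> Domain W \<union> Range W"
      using that by auto
    ultimately show ?thesis
      using f_K[of x] f_K[of y] f_else[of x] f_else[of y] d_inv[OF y] by (cases "x \<in> K") simp_all
  qed
  obtain j where j: "j \<in> {1..s}" "a = spike_point j (h j)"
    using a(1) h01 by (force simp: A_def spike_point_def)
  \<comment> \<open>As \<open>f Center = 0\<close>, every path from the center to \<open>a\<close>
    has length at least \<open>f a\<close>. This contradicts
    \<open>f a = d a + \<epsilon>\<close>.\<close>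
  have "f a \<le> d a"
    unfolding d_def
  proof (rule graph_dist_greatest)
    show "graph_path (add_wormholes W (star s)) (project W Center) (h j) (project W a)"
      using path[OF j(1), of "h j"] h01[OF j(1)] by (simp add: j(2))
    fix l assume "graph_path (add_wormholes W (star s)) (project W Center) l (project W a)"
    then have "\<bar>f Center - f a\<bar> \<le> l"
      by (rule lipschitz_le_path_length[rotated 2]) (use f_lip f_inv in auto)
    then show "f a \<le> l" by (simp add: f_def)
  qed
  then show False using f_K[OF aK] \<epsilon>_pos by simp
qed

section \<open>The diameter and its tight lower bound\<close>

text \<open>Routes through the center bound all distances by 2. A bound is required because the
  supremum of an unbounded set of reals is unspecified.\<close>

lemma star_wormholes_dist_le_diam:
  assumes "x \<in> points (star s)" "y \<in> points (star s)"
  shows "graph_dist (add_wormholes W (star s)) (project W x) (project W y)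
    \<le> graph_diam (add_wormholes W (star s))"
proof -
  let ?G = "add_wormholes W (star s)"
  have "graph_dist ?G X Y \<le> 2" if XY: "X \<in> points ?G" "Y \<in> points ?G" for X Y
  proof -
    obtain x y where xy: "x \<in> points (star s)" "y \<in> points (star s)" "X = project W x" "Y = project W y"
      using XY by (auto simp: points_add_wormholes)
    obtain i t where i: "x = spike_point i t" "i \<in> {1..s}" "0 \<le> t" "t \<le> 1"
      using xy(1) by (rule points_starE)
    obtain j u where j: "y = spike_point j u" "j \<in> {1..s}" "0 \<le> u" "u \<le> 1"
      using xy(2) by (rule points_starE)
    have "graph_dist ?G X Y \<le> t + u"
      unfolding xy i(1) j(1) using i j by (intro graph_dist_le star_wormholes_path_via_center)
    with i j show ?thesis by simp
  qed
  then have "bdd_above ((\<lambda>(x, y). graph_dist ?G x y) ` (points ?G \<times> points ?G))"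
    by (auto intro!: bdd_aboveI[where M = 2])
  moreover have "(project W x, project W y) \<in> points ?G \<times> points ?G"
    using assms by (simp add: points_add_wormholes)
  ultimately show ?thesis
    unfolding graph_diam_def by (metis (no_types, lifting) case_prod_conv cSUP_upper)
qed

text \<open>Points at heights \<open>t\<close> and \<open>u\<close> are joined through the center
  with length \<open>t + u\<close> and through the common tip with length \<open>2 - t - u\<close>.
  The two lengths add up to 2, so one of them is at most 1.\<close>

lemma graph_diam_tips_identified:
  assumes "s \<ge> 1" "\<And>i. i \<in> {1..s} \<Longrightarrow> project W (tip i) = project W (tip 1)"
  shows "graph_diam (add_wormholes W (star s)) \<le> 1"
  unfolding graph_diam_def
proof (rule cSUP_least)
  let ?G = "add_wormholes W (star s)"
  show "points ?G \<times> points ?G \<noteq> {}"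
    using points_star[OF assms(1)] by (simp add: points_add_wormholes)
  fix z assume "z \<in> points ?G \<times> points ?G"
  then obtain x y where xy: "x \<in> points (star s)" "y \<in> points (star s)" "z = (project W x, project W y)"
    by (auto simp: points_add_wormholes)
  obtain i t where i: "x = spike_point i t" "i \<in> {1..s}" "0 \<le> t" "t \<le> 1"
    using xy(1) by (rule points_starE)
  obtain j u where j: "y = spike_point j u" "j \<in> {1..s}" "0 \<le> u" "u \<le> 1"
    using xy(2) by (rule points_starE)
  have "project W (tip i) = project W (tip j)"
    using assms(2) i(2) j(2) by metis
  then have "graph_dist ?G (project W x) (project W y) \<le> \<bar>t - 1\<bar> + \<bar>1 - u\<bar>"
    using star_wormholes_segment[of i s t 1 W] star_wormholes_segment[of j s 1 u W] i j
    by (intro graph_dist_le graph_path_append[of _ _ _ "project W (tip j)"]) auto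
  moreover have "graph_dist ?G (project W x) (project W y) \<le> t + u"
    unfolding i(1) j(1) using i j by (intro graph_dist_le star_wormholes_path_via_center)
  ultimately show "(case z of (x, y) \<Rightarrow> graph_dist ?G x y) \<le> 1"
    using i j xy(3) by simp
qed

theorem proposition9:
  fixes s :: nat
  assumes "s \<ge> 1"
  shows "(\<forall>W. set W \<subseteq> points (star s) \<times> points (star s) \<and> length W = s - 1 \<longrightarrow>
            (\<exists>i\<in>{1..s}. graph_dist (add_wormholes (set W) (star s))
               (project (set W) Center) (project (set W) (tip i)) = 1) \<and>
            graph_diam (add_wormholes (set W) (star s)) \<ge> 1) \<and>
         (\<exists>W. set W \<subseteq> points (star s) \<times> points (star s) \<and> length W = s - 1 \<and>
            graph_diam (add_wormholes (set W) (star s)) = 1)"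
proof (intro conjI)
  have main: "\<exists>i\<in>{1..s}. graph_dist (add_wormholes (set W) (star s))
      (project (set W) Center) (project (set W) (tip i)) = 1"
    and diam: "graph_diam (add_wormholes (set W) (star s)) \<ge> 1"
    if W: "set W \<subseteq> points (star s) \<times> points (star s)" "length W = s - 1" for W
  proof -
    \<comment> \<open>Repeated wormholes in the list only lower the cardinality;
      \<open>s \<ge> 1\<close> makes the truncated \<open>s - 1\<close> strictly smaller than
      \<open>s\<close>.\<close>
    have "card (set W) < s" using card_length[of W] W(2) assms by simp
    then show *: "\<exists>i\<in>{1..s}. graph_dist (add_wormholes (set W) (star s))
        (project (set W) Center) (project (set W) (tip i)) = 1"
      using W(1) by (intro exists_tip_dist_one) auto
    then obtain i where "i \<in> {1..s}" "graph_dist (add_wormholes (set W) (star s))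
        (project (set W) Center) (project (set W) (tip i)) = 1" by blast
    then show "graph_diam (add_wormholes (set W) (star s)) \<ge> 1"
      using star_wormholes_dist_le_diam[of Center s "tip i" "set W"] points_star[OF assms] by auto
  qed
  then show "\<forall>W. set W \<subseteq> points (star s) \<times> points (star s) \<and> length W = s - 1 \<longrightarrow>
            (\<exists>i\<in>{1..s}. graph_dist (add_wormholes (set W) (star s))
               (project (set W) Center) (project (set W) (tip i)) = 1) \<and>
            graph_diam (add_wormholes (set W) (star s)) \<ge> 1"
    by blast
  \<comment> \<open>Join the first tip to each of the others; this uses exactly \<open>s - 1\<close>
    wormholes, none if \<open>s = 1\<close>.\<close>
  define W where "W = map (\<lambda>i. (tip 1, tip i)) [2..<Suc s]"
  have W: "set W \<subseteq> points (star s) \<times> points (star s)" "length W = s - 1"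
    using assms by (auto simp: W_def points_star)
  have "project (set W) (tip i) = project (set W) (tip 1)" if "i \<in> {1..s}" for i
  proof (cases "i = 1")
    case False
    then have "(tip 1, tip i) \<in> set W" using that by (auto simp: W_def)
    then show ?thesis by (auto simp: project_eq_iff)
  qed simp
  then have "graph_diam (add_wormholes (set W) (star s)) \<le> 1"
    by (rule graph_diam_tips_identified[OF assms])
  with diam[OF W] W show "\<exists>W. set W \<subseteq> points (star s) \<times> points (star s) \<and> length W = s - 1 \<and>
            graph_diam (add_wormholes (set W) (star s)) = 1"
    by (intro exI[of _ W]) auto
qed

end
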